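(* Let $\mathcal{F}$ be a 2-construction scheme. For each $\alpha\in\omega_1$ define $$L_\alpha=\{2k+\Xi_\alpha(k): k\in\omega\setminus 1,\ \Xi_\alpha(k)\ge 0\},\qquad R_\alpha=\{2k+(1-\Xi_\alpha(k)): k\in\omega\setminus 1,\ \Xi_\alpha(k)\ge0\}.$$ Then $(L_\alpha,R_\alpha)_{\alpha\in\omega_1}$ is a Hausdorff gap.
   Context: A type is a sequence $\tau=\langle m_k,n_{k+1},r_{k+1}\rangle_{k\in\omega}$ of natural numbers with $m_0=1$, $n_{k+1}\ge2$, $m_k>r_{k+1}$, $m_{k+1}=r_{k+1}+(m_k-r_{k+1})n_{k+1}$; it is good if for every $r\in\omega$ there are infinitely many $k$ with $r_k=r$ (all types are assumed good). A construction scheme of type $\tau$ is a family $\mathcal{F}$ of nonempty finite subsets of $\omega_1$, cofinal in the finite subsets of $\omega_1$ under $\subseteq$, each of cardinality $m_k$ for some $k$, such that, writing $\mathcal{F}_k=\{F\in\mathcal{F}:|F|=m_k\}$: (i) for $E,F\in\mathcal{F}_k$, $E\cap F$ is an initial segment of both $E$ and $F$; (ii) every $F\in\mathcal{F}_{k+1}$ is a union $F_0\cup\dots\cup F_{n_{k+1}-1}$ of members of $\mathcal{F}_k$ forming a $\Delta$-system with root $R(F)$, $|R(F)|=r_{k+1}$, and $R(F)<F_0\setminus R(F)<\dots<F_{n_{k+1}-1}\setminus R(F)$ (this decomposition is unique). A 2-construction scheme is a construction scheme whose type has $n_{k+1}=2$ for all $k$. For $\alpha\in\omega_1$: $\Xi_\alpha(0)=0$,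 and for $k\ge1$ take any $F\in\mathcal{F}_k$ with $\alpha\in F$ and set $\Xi_\alpha(k)=-1$ if $\alpha\in R(F)$ and $\Xi_\alpha(k)=i$ if $\alpha\in F_i\setminus R(F)$ (this does not depend on $F$). A pair $(L_\alpha,R_\alpha)_{\alpha\in\omega_1}$ of $\subseteq^*$-increasing sequences of subsets of $\omega$ with $L_\alpha\cap R_\beta$ finite for all $\alpha,\beta$ is an $(\omega_1,\omega_1)$-pregap; it is a gap if there is no $C\subseteq\omega$ with $L_\alpha\setminus C$ and $C\cap R_\alpha$ finite for all $\alpha$. It is Hausdorff if for every $\beta\in\omega_1$ and $k\in\omega$ the set $\{\alpha<\beta: L_\beta\cap R_\alpha\subseteq k\}$ is finite. *)

theory Defs
  imports "HOL-Library.Countable_Set_Type"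
begin

section \<open>The first uncountable ordinal\<close>

text \<open>
  The field of the cardinal successor of \<open>natLeq\<close>, with its well-order: a well-order of type
  $\omega_1$, as the lemmas \<open>uncountable_omega1\<close> and \<open>countable_lessThan_omega1\<close> confirm.
\<close>

typedef omega1 = "Field (cardSuc natLeq)"
proof -
  have "Field (cardSuc natLeq) \<noteq> {}"
    using cardSuc_finite[OF natLeq_Card_order] Field_natLeq by fastforce
  then show ?thesis by blast
qed

instantiation omega1 :: wellorder
begin

definition less_eq_omega1 :: "omega1 \<Rightarrow> omega1 \<Rightarrow> bool" where
  "x \<le> y \<longleftrightarrow> (Rep_omega1 x, Rep_omega1 y) \<in> cardSuc natLeq"

definition less_omega1 :: "omega1 \<Rightarrow> omega1 \<Rightarrow> bool" where
  "(x :: omega1) < y \<longleftrightarrow> x \<le> y \<and> x \<noteq> y"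

instance
proof -
  have wo: "well_order_on (Field (cardSuc natLeq)) (cardSuc natLeq)"
    using card_order_on_well_order_on[OF cardSuc_Card_order[OF natLeq_Card_order]] .
  have lin: "Linear_order (cardSuc natLeq)" and wf: "wf (cardSuc natLeq - Id)"
    using wo by (auto simp: well_order_on_def)
  have refl: "x \<le> x" for x :: omega1
    using lin Rep_omega1[of x]
    by (auto simp: less_eq_omega1_def linear_order_on_def partial_order_on_def
        preorder_on_def refl_on_def)
  have tr: "x \<le> z" if "x \<le> y" "y \<le> z" for x y z :: omega1
    using lin that
    by (auto simp: less_eq_omega1_def linear_order_on_def partial_order_on_def
        preorder_on_def elim: transE)
  have anti: "x = y" if "x \<le> y" "y \<le> x" for x y :: omega1
    using lin that Rep_omega1_inject[of x y]
    by (auto simp: less_eq_omega1_def linear_order_on_def partial_order_on_def antisym_def)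
  have tot: "x \<le> y \<or> y \<le> x" for x y :: omega1
    using lin Rep_omega1[of x] Rep_omega1[of y] refl
    by (metis less_eq_omega1_def linear_order_on_def total_on_def)
  have ind: "P a" if step: "\<And>x. (\<And>y. y < x \<Longrightarrow> P y) \<Longrightarrow> P x" for P and a :: omega1
  proof -
    have "wf (inv_image (cardSuc natLeq - Id) Rep_omega1)"
      using wf by (rule wf_inv_image)
    moreover have "inv_image (cardSuc natLeq - Id) Rep_omega1 = {(x, y). x < y}"
      by (auto simp: less_omega1_def less_eq_omega1_def Rep_omega1_inject inv_image_def)
    ultimately have "wf {(x :: omega1, y). x < y}" by simp
    then show ?thesis
      by (induction a rule: wf_induct_rule) (use step in auto)
  qed
  show "OFCLASS(omega1, wellorder_class)"
  proof
    fix x y z :: omega1 and P and a :: omega1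
    show "x < y \<longleftrightarrow> x \<le> y \<and> \<not> y \<le> x"
      using anti refl by (auto simp: less_omega1_def)
    show "x \<le> x" by (rule refl)
    show "x \<le> y \<Longrightarrow> y \<le> z \<Longrightarrow> x \<le> z" by (rule tr)
    show "x \<le> y \<Longrightarrow> y \<le> x \<Longrightarrow> x = y" by (rule anti)
    show "x \<le> y \<or> y \<le> x" by (rule tot)
    show "P a" if "\<And>x. (\<And>y. y < x \<Longrightarrow> P y) \<Longrightarrow> P x"
      using that by (rule ind)
  qed
qed

end

lemma uncountable_omega1:
  includes cardinal_syntax
  shows "uncountable (UNIV :: omega1 set)"
proof
  assume "countable (UNIV :: omega1 set)"
  then have "countable (Rep_omega1 ` UNIV)" by (rule countable_image)
  then have "|Field (cardSuc natLeq)| \<le>o natLeq"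
    using type_definition.Rep_range[OF type_definition_omega1]
    by (simp add: countable_card_le_natLeq)
  then have "cardSuc natLeq \<le>o natLeq"
    using card_of_Field_ordIso[OF cardSuc_Card_order[OF natLeq_Card_order]]
      ordIso_ordLeq_trans ordIso_symmetric by blast
  then show False
    using cardSuc_greater[OF natLeq_Card_order] not_ordLess_ordLeq by blast
qed

lemma countable_lessThan_omega1:
  includes cardinal_syntax
  shows "countable {..<a :: omega1}"
proof -
  let ?r = "cardSuc natLeq"
  have "|underS ?r (Rep_omega1 a)| <o ?r"
    using card_of_underS[OF cardSuc_Card_order[OF natLeq_Card_order]] Rep_omega1 by blast
  then have "|underS ?r (Rep_omega1 a)| \<le>o natLeq"
    using cardSuc_ordLeq_ordLess[OF natLeq_Card_order card_of_Card_order] by blast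
  then have "countable (underS ?r (Rep_omega1 a))"
    by (simp add: countable_card_le_natLeq)
  moreover have "Rep_omega1 ` {..<a} \<subseteq> underS ?r (Rep_omega1 a)"
    by (auto simp: underS_def less_omega1_def less_eq_omega1_def Rep_omega1_inject)
  ultimately have "countable (Rep_omega1 ` {..<a})"
    using countable_subset by blast
  then show ?thesis
    by (rule countable_image_inj_on) (simp add: inj_on_def Rep_omega1_inject)
qed


section \<open>Construction schemes\<close>

text \<open>
  A type is given by three sequences \<open>m\<close>, \<open>n\<close>, \<open>r\<close>; the values \<open>n 0\<close> and \<open>r 0\<close> are junk and
  are never used.
\<close>

definition scheme_type :: "(nat \<Rightarrow> nat) \<Rightarrow> (nat \<Rightarrow> nat) \<Rightarrow> (nat \<Rightarrow> nat) \<Rightarrow> bool" where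
  "scheme_type m n r \<longleftrightarrow> m 0 = 1 \<and>
     (\<forall>k. n (Suc k) \<ge> 2 \<and> r (Suc k) < m k \<and>
          m (Suc k) = r (Suc k) + (m k - r (Suc k)) * n (Suc k))"

definition good_type :: "(nat \<Rightarrow> nat) \<Rightarrow> (nat \<Rightarrow> nat) \<Rightarrow> (nat \<Rightarrow> nat) \<Rightarrow> bool" where
  "good_type m n r \<longleftrightarrow> scheme_type m n r \<and> (\<forall>j. infinite {k. k \<ge> 1 \<and> r k = j})"

definition level :: "(nat \<Rightarrow> nat) \<Rightarrow> omega1 set set \<Rightarrow> nat \<Rightarrow> omega1 set set" where
  "level m \<F> k = {F \<in> \<F>. card F = m k}"

definition initial_segment :: "omega1 set \<Rightarrow> omega1 set \<Rightarrow> bool" where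
  "initial_segment A B \<longleftrightarrow> A \<subseteq> B \<and> (\<forall>x\<in>A. \<forall>y\<in>B. y < x \<longrightarrow> y \<in> A)"

definition set_less :: "omega1 set \<Rightarrow> omega1 set \<Rightarrow> bool" where
  "set_less A B \<longleftrightarrow> (\<forall>a\<in>A. \<forall>b\<in>B. a < b)"

text \<open>
  \<open>decomposition m n r \<F> k F Fs R\<close>: the list \<open>Fs\<close> is $F_0,\dots,F_{n_{k+1}-1}$ and \<open>R\<close> is the
  root \<open>R(F)\<close>, for \<open>F\<close> on level $k+1$.
\<close>

definition decomposition ::
  "(nat \<Rightarrow> nat) \<Rightarrow> (nat \<Rightarrow> nat) \<Rightarrow> (nat \<Rightarrow> nat) \<Rightarrow> omega1 set set \<Rightarrow> nat \<Rightarrow>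
   omega1 set \<Rightarrow> omega1 set list \<Rightarrow> omega1 set \<Rightarrow> bool" where
  "decomposition m n r \<F> k F Fs R \<longleftrightarrow>
     length Fs = n (Suc k) \<and> set Fs \<subseteq> level m \<F> k \<and> F = \<Union> (set Fs) \<and>
     (\<forall>i<length Fs. \<forall>j<length Fs. i \<noteq> j \<longrightarrow> Fs ! i \<inter> Fs ! j = R) \<and>
     card R = r (Suc k) \<and>
     (\<forall>i<length Fs. set_less R (Fs ! i - R)) \<and>
     (\<forall>j<length Fs. \<forall>i<j. set_less (Fs ! i - R) (Fs ! j - R))"

definition construction_scheme ::
  "(nat \<Rightarrow> nat) \<Rightarrow> (nat \<Rightarrow> nat) \<Rightarrow> (nat \<Rightarrow> nat) \<Rightarrow> omega1 set set \<Rightarrow> bool" where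
  "construction_scheme m n r \<F> \<longleftrightarrow>
     good_type m n r \<and>
     (\<forall>F\<in>\<F>. finite F \<and> F \<noteq> {} \<and> (\<exists>k. card F = m k)) \<and>
     (\<forall>A. finite A \<longrightarrow> (\<exists>F\<in>\<F>. A \<subseteq> F)) \<and>
     (\<forall>k. \<forall>E\<in>level m \<F> k. \<forall>F\<in>level m \<F> k.
        initial_segment (E \<inter> F) E \<and> initial_segment (E \<inter> F) F) \<and>
     (\<forall>k. \<forall>F\<in>level m \<F> (Suc k). \<exists>Fs R. decomposition m n r \<F> k F Fs R)"

definition two_construction_scheme ::
  "(nat \<Rightarrow> nat) \<Rightarrow> (nat \<Rightarrow> nat) \<Rightarrow> (nat \<Rightarrow> nat) \<Rightarrow> omega1 set set \<Rightarrow> bool" where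
  "two_construction_scheme m n r \<F> \<longleftrightarrow>
     construction_scheme m n r \<F> \<and> (\<forall>k. n (Suc k) = 2)"

text \<open>
  In a construction scheme the decomposition of \<open>F\<close> is unique, so that the following denotes
  the pair of $(F_0,\dots,F_{n_{k+1}-1})$ and \<open>R(F)\<close>.
\<close>

definition the_decomposition ::
  "(nat \<Rightarrow> nat) \<Rightarrow> (nat \<Rightarrow> nat) \<Rightarrow> (nat \<Rightarrow> nat) \<Rightarrow> omega1 set set \<Rightarrow> nat \<Rightarrow>
   omega1 set \<Rightarrow> omega1 set list \<times> omega1 set" where
  "the_decomposition m n r \<F> k F = (THE (Fs, R). decomposition m n r \<F> k F Fs R)"

text \<open>
  \<open>Xi m n r \<F> \<alpha> k\<close> is $\Xi_\alpha(k)$. The value does not depend on the member \<open>F\<close> of level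
  \<open>k\<close> containing \<open>\<alpha>\<close>, whence the use of \<open>SOME\<close>.
\<close>

definition Xi ::
  "(nat \<Rightarrow> nat) \<Rightarrow> (nat \<Rightarrow> nat) \<Rightarrow> (nat \<Rightarrow> nat) \<Rightarrow> omega1 set set \<Rightarrow> omega1 \<Rightarrow> nat \<Rightarrow> int" where
  "Xi m n r \<F> \<alpha> k =
     (case k of
        0 \<Rightarrow> 0
      | Suc l \<Rightarrow>
          (let F = (SOME F. F \<in> level m \<F> (Suc l) \<and> \<alpha> \<in> F);
               (Fs, R) = the_decomposition m n r \<F> l F
           in if \<alpha> \<in> R then -1 else int (THE i. i < length Fs \<and> \<alpha> \<in> Fs ! i - R)))"


section \<open>Gaps\<close>

definition almost_subset :: "nat set \<Rightarrow> nat set \<Rightarrow> bool" where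
  "almost_subset A B \<longleftrightarrow> finite (A - B)"

definition pregap :: "(omega1 \<Rightarrow> nat set) \<Rightarrow> (omega1 \<Rightarrow> nat set) \<Rightarrow> bool" where
  "pregap L R \<longleftrightarrow>
     (\<forall>\<alpha> \<beta>. \<alpha> < \<beta> \<longrightarrow> almost_subset (L \<alpha>) (L \<beta>) \<and> almost_subset (R \<alpha>) (R \<beta>)) \<and>
     (\<forall>\<alpha> \<beta>. finite (L \<alpha> \<inter> R \<beta>))"

definition gap :: "(omega1 \<Rightarrow> nat set) \<Rightarrow> (omega1 \<Rightarrow> nat set) \<Rightarrow> bool" where
  "gap L R \<longleftrightarrow> pregap L R \<and>
     \<not> (\<exists>C. \<forall>\<alpha>. finite (L \<alpha> - C) \<and> finite (C \<inter> R \<alpha>))"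

definition hausdorff :: "(omega1 \<Rightarrow> nat set) \<Rightarrow> (omega1 \<Rightarrow> nat set) \<Rightarrow> bool" where
  "hausdorff L R \<longleftrightarrow> (\<forall>\<beta> k. finite {\<alpha>. \<alpha> < \<beta> \<and> L \<beta> \<inter> R \<alpha> \<subseteq> {..<k}})"

definition hausdorff_gap :: "(omega1 \<Rightarrow> nat set) \<Rightarrow> (omega1 \<Rightarrow> nat set) \<Rightarrow> bool" where
  "hausdorff_gap L R \<longleftrightarrow> gap L R \<and> hausdorff L R"

end

theory Submission
  imports Defs
begin

text \<open>
  For \<open>\<alpha> < \<beta>\<close> let \<open>\<rho>\<close> be the least level with a member containing both. Above \<open>\<rho>\<close>, every
  member containing both has a piece containing both, so the values of \<open>\<Xi>\<close> at \<open>\<alpha>\<close> and \<open>\<beta>\<close>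
  agree unless the value at \<open>\<alpha>\<close> is \<open>-1\<close>; this gives a pregap. At level \<open>\<rho>\<close> the two points are
  separated, with value \<open>0\<close> at \<open>\<alpha>\<close> and \<open>1\<close> at \<open>\<beta>\<close>, so \<open>2\<rho> + 1\<close> lies in
  \<open>L \<beta> \<inter> R \<alpha>\<close>. Since a member of level \<open>k\<close> is finite and its part below \<open>\<beta>\<close> depends only on \<open>k\<close>
  and \<open>\<beta>\<close>, only finitely many \<open>\<alpha>\<close> have \<open>\<rho> \<le> k\<close>, which is Hausdorff's condition. If a set
  separated the pregap, it would do so with a uniform finite error on an uncountable set of
  indices, contradicting that condition.
\<close>

section \<open>Initial segments of finite sets\<close>

text \<open>If \<open>x\<close> lay in \<open>I\<close> but not in \<open>J\<close>, all of
  \<open>J\<close> would lie below \<open>x\<close>, hence in \<open>E\<close> and then in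
  \<open>I\<close>, making \<open>J\<close> a proper subset of a finite set of the same
  size.\<close>

lemma initial_segment_mem_iff:
  assumes "finite E" "finite F"
    and "initial_segment (E \<inter> F) E" "initial_segment (E \<inter> F) F"
    and "initial_segment I E" "initial_segment J F" "card I = card J"
    and "x \<in> E" "x \<in> F"
  shows "x \<in> I \<longleftrightarrow> x \<in> J"
proof -
  have *: "x \<in> B" if "finite C" "initial_segment (C \<inter> D) C" "initial_segment (C \<inter> D) D"
    "initial_segment A C" "initial_segment B D" "card A = card B" "x \<in> C" "x \<in> D" "x \<in> A"
    for A B C D
  proof (rule ccontr)
    assume "x \<notin> B"
    have "B \<subseteq> A"
    proof
      fix y assume "y \<in> B"
      then have "y \<in> D" "y < x"
        using that \<open>x \<notin> B\<close> unfolding initial_segment_def by (blast, metis linorder_neqE)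
      then show "y \<in> A" using that unfolding initial_segment_def by blast
    qed
    then have "B \<subset> A" using \<open>x \<notin> B\<close> \<open>x \<in> A\<close> by blast
    moreover have "finite A"
      using that finite_subset unfolding initial_segment_def by blast
    ultimately show False using psubset_card_mono[of A B] that by simp
  qed
  note swapped = assms(3,4)[unfolded Int_commute[of E F]]
  show ?thesis
  proof
    show "x \<in> I \<Longrightarrow> x \<in> J" using *[OF assms(1,3-9)] .
    show "x \<in> J \<Longrightarrow> x \<in> I"
      using *[OF assms(2) swapped(2,1) assms(6,5) assms(7)[symmetric] assms(9,8)] .
  qed
qed

lemma initial_segment_unique:
  assumes "finite F" "initial_segment I F" "initial_segment J F" "card I = card J"
  shows "I = J"
proof -
  have "initial_segment (F \<inter> F) F" by (simp add: initial_segment_def)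
  then have "x \<in> I \<longleftrightarrow> x \<in> J" if "x \<in> F" for x
    using initial_segment_mem_iff[of F F I J x] assms that by blast
  then show ?thesis using assms unfolding initial_segment_def by blast
qed

section \<open>Hausdorff's condition excludes separation\<close>

text \<open>Otherwise counting the predecessors in \<open>X\<close> would inject \<open>X\<close>
  into the natural numbers.\<close>

lemma uncountable_infinite_below:
  fixes X :: "'a :: linorder set"
  assumes "uncountable X"
  obtains b where "b \<in> X" "infinite (X \<inter> {..<b})"
proof (rule ccontr)
  assume "\<not> thesis"
  then have fin: "\<And>b. b \<in> X \<Longrightarrow> finite (X \<inter> {..<b})" using that by blast
  have less: "card (X \<inter> {..<a}) < card (X \<inter> {..<b})" if "a \<in> X" "b \<in> X" "a < b" for a b
    using that by (intro psubset_card_mono fin) auto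
  have "inj_on (\<lambda>b. card (X \<inter> {..<b})) X"
  proof (rule inj_onI)
    fix a b assume "a \<in> X" "b \<in> X" "card (X \<inter> {..<a}) = card (X \<inter> {..<b})"
    then show "a = b" using less[of a b] less[of b a] by (cases a b rule: linorder_cases) auto
  qed
  then show False using assms by (meson countableI)
qed

lemma hausdorff_no_separation:
  assumes "hausdorff L R"
  shows "\<not> (\<exists>C. \<forall>\<alpha>. finite (L \<alpha> - C) \<and> finite (C \<inter> R \<alpha>))"
proof
  assume "\<exists>C. \<forall>\<alpha>. finite (L \<alpha> - C) \<and> finite (C \<inter> R \<alpha>)"
  then obtain C where C: "finite ((L \<alpha> - C) \<union> (C \<inter> R \<alpha>))" for \<alpha> by blast
  \<comment> \<open>\<open>X N\<close> collects the indices at which \<open>C\<close> errs only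
    below \<open>N\<close>. For \<alpha> and \<beta> in it, a point of
    \<open>L \<beta> \<inter> R \<alpha>\<close> outside \<open>C\<close> is an error at \<beta>,
    one inside \<open>C\<close> an error at \<alpha>; either way it is below
    \<open>N\<close>.\<close>
  define X where "X N = {\<alpha>. (L \<alpha> - C) \<union> (C \<inter> R \<alpha>) \<subseteq> {..<N}}" for N :: nat
  have "\<exists>N. \<alpha> \<in> X N" for \<alpha>
    using C[of \<alpha>] by (auto simp: X_def finite_nat_iff_bounded simp del: finite_Un)
  then have "(\<Union>N. X N) = UNIV" by blast
  then obtain N where "uncountable (X N)"
    using uncountable_omega1 by (metis countable_UN uncountable_def countableI_type)
  then obtain \<beta> where \<beta>: "\<beta> \<in> X N" "infinite (X N \<inter> {..<\<beta>})"
    by (rule uncountable_infinite_below)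
  have "X N \<inter> {..<\<beta>} \<subseteq> {\<alpha>. \<alpha> < \<beta> \<and> L \<beta> \<inter> R \<alpha> \<subseteq> {..<N}}"
    using \<beta>(1) unfolding X_def by blast
  then show False
    using \<beta>(2) assms finite_subset unfolding hausdorff_def by blast
qed

section \<open>Levels and two-piece decompositions\<close>

locale two_scheme =
  fixes m n r :: "nat \<Rightarrow> nat" and \<F> :: "omega1 set set"
  assumes scheme: "two_construction_scheme m n r \<F>"
begin

lemma n_Suc: "n (Suc k) = 2"
  using scheme by (simp add: two_construction_scheme_def)

lemma strict_mono_m: "strict_mono m"
  unfolding strict_mono_Suc_iff
proof
  fix k
  have "r (Suc k) < m k" "m (Suc k) = r (Suc k) + (m k - r (Suc k)) * n (Suc k)"
    using scheme
    by (auto simp: two_construction_scheme_def construction_scheme_def good_type_def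
        scheme_type_def)
  then show "m k < m (Suc k)" using n_Suc by simp
qed

lemma finite_level: "F \<in> level m \<F> k \<Longrightarrow> finite F"
  using scheme
  by (simp add: two_construction_scheme_def construction_scheme_def level_def)

lemma cofinal:
  assumes "finite A"
  shows "\<exists>k. \<exists>F\<in>level m \<F> k. A \<subseteq> F"
proof -
  have "\<exists>F\<in>\<F>. A \<subseteq> F" and card: "\<forall>F\<in>\<F>. \<exists>k. card F = m k"
    using scheme assms by (simp_all add: two_construction_scheme_def construction_scheme_def)
  then obtain F where F: "F \<in> \<F>" "A \<subseteq> F" by (elim bexE)
  moreover obtain k where "card F = m k" using card F(1) by (elim ballE exE) auto
  ultimately have "F \<in> level m \<F> k" by (simp add: level_def)
  with F(2) show ?thesis by (intro exI bexI)
qed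

lemma level_initial_segment:
  assumes "E \<in> level m \<F> k" "F \<in> level m \<F> k"
  shows "initial_segment (E \<inter> F) E" "initial_segment (E \<inter> F) F"
  using assms scheme unfolding two_construction_scheme_def construction_scheme_def by blast+

lemma level_down_closed:
  assumes "E \<in> level m \<F> k" "F \<in> level m \<F> k" "\<beta> \<in> E" "\<beta> \<in> F" "\<alpha> \<le> \<beta>" "\<alpha> \<in> E"
  shows "\<alpha> \<in> F"
  using level_initial_segment(1)[OF assms(1,2)] assms(3-6)
  unfolding initial_segment_def by (cases "\<alpha> = \<beta>") auto

lemma decomposition_iff:
  "decomposition m n r \<F> k F Fs R \<longleftrightarrow>
    (\<exists>G H. Fs = [G, H] \<and> G \<in> level m \<F> k \<and> H \<in> level m \<F> k \<and> F = G \<union> H \<and> G \<inter> H = R \<and>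
      card R = r (Suc k) \<and> set_less R (G - R) \<and> set_less R (H - R) \<and>
      set_less (G - R) (H - R))"
proof -
  have "length Fs = 2 \<longleftrightarrow> (\<exists>G H. Fs = [G, H])"
    by (auto simp: numeral_2_eq_2 length_Suc_conv)
  then show ?thesis
    by (auto simp: decomposition_def n_Suc less_Suc_eq numeral_2_eq_2 all_conj_distrib
        imp_conjL Int_commute)
qed

lemma decomposition_exists:
  assumes "F \<in> level m \<F> (Suc k)"
  obtains G H where "decomposition m n r \<F> k F [G, H] (G \<inter> H)"
    "G \<in> level m \<F> k" "H \<in> level m \<F> k" "F = G \<union> H"
proof -
  have "\<exists>Fs R. decomposition m n r \<F> k F Fs R"
    using assms scheme by (simp add: two_construction_scheme_def construction_scheme_def)
  then obtain Fs R where dec: "decomposition m n r \<F> k F Fs R" by (elim exE)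
  then obtain G H where GH: "Fs = [G, H]" "G \<inter> H = R"
    "G \<in> level m \<F> k" "H \<in> level m \<F> k" "F = G \<union> H"
    unfolding decomposition_iff by (elim exE conjE)
  show thesis using that[of G H] dec GH by simp
qed

text \<open>\<open>F\<close> consists of the consecutive blocks \<open>R\<close>,
  \<open>G - R\<close>, \<open>H - R\<close>; the first one and the first two make up
  \<open>R\<close> and \<open>G\<close>.\<close>

lemma decomposition_initial_segment:
  assumes "decomposition m n r \<F> k F [G, H] R"
  shows "initial_segment R F" "initial_segment G F"
proof -
  have "F = G \<union> H" "G \<inter> H = R"
    "set_less R (G - R)" "set_less R (H - R)" "set_less (G - R) (H - R)"
    using assms unfolding decomposition_iff by auto
  then have "R \<subseteq> F" "G \<subseteq> F" and less: "\<And>x y. x \<in> R \<Longrightarrow> y \<in> F - R \<Longrightarrow> x < y"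
    "\<And>x y. x \<in> G \<Longrightarrow> y \<in> F - G \<Longrightarrow> x < y"
    unfolding set_less_def by blast+
  then show "initial_segment R F" "initial_segment G F"
    unfolding initial_segment_def by (meson DiffI less_asym subsetD)+
qed

text \<open>The root and the first piece are initial segments of \<open>F\<close> of sizes fixed by
  the level, so \<open>F\<close> determines them; the second piece is the rest of \<open>F\<close>
  together with the root.\<close>

lemma decomposition_unique:
  assumes "finite F" "decomposition m n r \<F> k F Fs R" "decomposition m n r \<F> k F Fs' R'"
  shows "Fs = Fs' \<and> R = R'"
proof -
  obtain G H where GH: "Fs = [G, H]" "card G = m k" "F = G \<union> H" "G \<inter> H = R"
    "card R = r (Suc k)"
    using assms(2) by (auto simp: decomposition_iff level_def)
  obtain G' H' where GH': "Fs' = [G', H']" "card G' = m k" "F = G' \<union> H'" "G' \<inter> H' = R'"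
    "card R' = r (Suc k)"
    using assms(3) by (auto simp: decomposition_iff level_def)
  note init = decomposition_initial_segment[OF assms(2)[unfolded GH(1)]]
    decomposition_initial_segment[OF assms(3)[unfolded GH'(1)]]
  have R: "R = R'" using initial_segment_unique[OF assms(1) init(1,3)] GH(5) GH'(5) by simp
  have G: "G = G'"
    using initial_segment_unique[OF assms(1) init(2,4)] GH(2) GH'(2) by simp
  have "H = (F - G) \<union> R" "H' = (F - G') \<union> R'" using GH(3,4) GH'(3,4) by blast+
  then show ?thesis using R G GH(1) GH'(1) by simp
qed

lemma the_decomposition_eq:
  assumes "F \<in> level m \<F> (Suc k)" "decomposition m n r \<F> k F Fs R"
  shows "the_decomposition m n r \<F> k F = (Fs, R)"
  unfolding the_decomposition_def
proof (rule the_equality)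
  fix p assume "case p of (Fs, R) \<Rightarrow> decomposition m n r \<F> k F Fs R"
  then show "p = (Fs, R)"
    using decomposition_unique[OF finite_level[OF assms(1)] assms(2)] by (cases p) auto
qed (use assms(2) in simp)

section \<open>Evaluating \<Xi>\<close>

text \<open>The member \<open>E\<close> picked by \<open>SOME\<close> may differ from
  \<open>F\<close>. The roots of both have the same size, and so do the first pieces; all are
  initial segments, so \<alpha> has the same position in \<open>E\<close> as in
  \<open>F\<close>.\<close>

lemma Xi_Suc:
  assumes F: "F \<in> level m \<F> (Suc k)" and dec: "decomposition m n r \<F> k F [G, H] R"
    and "\<alpha> \<in> F"
  shows "Xi m n r \<F> \<alpha> (Suc k) = (if \<alpha> \<in> R then -1 else if \<alpha> \<in> G then 0 else 1)"
proof -
  define E where "E = (SOME F. F \<in> level m \<F> (Suc k) \<and> \<alpha> \<in> F)"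
  have E: "E \<in> level m \<F> (Suc k)" "\<alpha> \<in> E"
    using someI[of "\<lambda>F. F \<in> level m \<F> (Suc k) \<and> \<alpha> \<in> F" F] assms by (auto simp: E_def)
  obtain G' H' where dec': "decomposition m n r \<F> k E [G', H'] (G' \<inter> H')" and "E = G' \<union> H'"
    using decomposition_exists[OF E(1)] by metis
  have card: "card G = m k" "card R = r (Suc k)" "card G' = m k" "card (G' \<inter> H') = r (Suc k)"
    using dec dec' by (auto simp: decomposition_iff level_def)
  have mem_iff: "\<alpha> \<in> I \<longleftrightarrow> \<alpha> \<in> J"
    if "initial_segment I E" "initial_segment J F" "card I = card J" for I J
    using initial_segment_mem_iff[of E F I J \<alpha>] level_initial_segment[OF E(1) F]
      finite_level[OF E(1)] finite_level[OF F] E(2) \<open>\<alpha> \<in> F\<close> that by blast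
  have R: "\<alpha> \<in> G' \<inter> H' \<longleftrightarrow> \<alpha> \<in> R" and G: "\<alpha> \<in> G' \<longleftrightarrow> \<alpha> \<in> G"
    using mem_iff decomposition_initial_segment[OF dec] decomposition_initial_segment[OF dec']
      card by metis+
  have "(THE i. i < length [G', H'] \<and> \<alpha> \<in> [G', H'] ! i - G' \<inter> H') = (if \<alpha> \<in> G' then 0 else 1)"
    if "\<alpha> \<notin> G' \<inter> H'"
    using that E(2) \<open>E = G' \<union> H'\<close>
    by (intro the_equality) (auto simp: less_Suc_eq nth_Cons')
  then have "Xi m n r \<F> \<alpha> (Suc k)
      = (if \<alpha> \<in> G' \<inter> H' then -1 else if \<alpha> \<in> G' then 0 else 1)"
    unfolding Xi_def nat.case E_def[symmetric] the_decomposition_eq[OF E(1) dec'] Let_def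
    by (simp del: length_Cons)
  then show ?thesis by (simp only: R G)
qed

section \<open>Levels that join two points\<close>

text \<open>Cofinality does not control the level. Covering also a set of size \<open>m k\<close>
  forces a level of at least \<open>k\<close>, from which one descends through pieces containing
  \<alpha>.\<close>

lemma ex_level: "\<exists>F\<in>level m \<F> k. \<alpha> \<in> F"
proof -
  have descend: "\<exists>F\<in>level m \<F> k. \<alpha> \<in> F" if "F \<in> level m \<F> (k + d)" "\<alpha> \<in> F" for F d
    using that
  proof (induction d arbitrary: F)
    case (Suc d)
    then show ?case by (metis Un_iff add_Suc_right decomposition_exists)
  qed auto
  have "infinite (UNIV :: omega1 set)"
    using uncountable_omega1 countable_finite by blast
  then obtain A :: "omega1 set" where A: "finite A" "card A = m k"
    using infinite_arbitrarily_large by blast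
  obtain j F where F: "F \<in> level m \<F> j" "insert \<alpha> A \<subseteq> F"
    using cofinal[of "insert \<alpha> A"] A by auto
  have "m k \<le> m j"
    using card_mono[OF finite_level[OF F(1)], of A] A F by (auto simp: level_def)
  then have "k \<le> j" using strict_mono_m strict_mono_less_eq by blast
  then show ?thesis using descend[of F "j - k"] F by auto
qed

text \<open>For \<alpha> \<le> \<beta> this expresses \<rho> \<le> k, by
  \<open>joined_mono\<close>.\<close>

definition joined :: "nat \<Rightarrow> omega1 \<Rightarrow> omega1 \<Rightarrow> bool" where
  "joined k \<alpha> \<beta> \<longleftrightarrow> (\<exists>F\<in>level m \<F> k. \<alpha> \<in> F \<and> \<beta> \<in> F)"

text \<open>Two members of one level that share \<beta> have the same elements below \<beta>, so one
  witness for \<open>joined\<close> speaks for all members through \<beta>.\<close>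

lemma joined_mem:
  assumes "joined k \<alpha> \<beta>" "\<alpha> \<le> \<beta>" "F \<in> level m \<F> k" "\<beta> \<in> F"
  shows "\<alpha> \<in> F"
  using assms level_down_closed unfolding joined_def by blast

lemma joined_mono:
  assumes "joined k \<alpha> \<beta>" "\<alpha> \<le> \<beta>" "k \<le> l"
  shows "joined l \<alpha> \<beta>"
  using assms(3,1)
proof (induction l rule: dec_induct)
  case (step l)
  obtain F where F: "F \<in> level m \<F> (Suc l)" "\<beta> \<in> F" using ex_level by blast
  then obtain G where "G \<in> level m \<F> l" "G \<subseteq> F" "\<beta> \<in> G"
    using decomposition_exists[OF F(1)] by (metis Un_iff Un_upper1 Un_upper2)
  then have "\<alpha> \<in> F" using joined_mem[OF step.IH[OF step.prems] assms(2)] by blast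
  then show ?case using F unfolding joined_def by blast
qed

lemma ex_joined: "\<exists>k. joined k \<alpha> \<beta>"
  using cofinal[of "{\<alpha>, \<beta>}"] unfolding joined_def by auto

lemma finite_joined: "finite {\<alpha>. \<alpha> \<le> \<beta> \<and> joined k \<alpha> \<beta>}"
proof -
  obtain F where F: "F \<in> level m \<F> k" "\<beta> \<in> F" using ex_level by blast
  then have "{\<alpha>. \<alpha> \<le> \<beta> \<and> joined k \<alpha> \<beta>} \<subseteq> F" by (auto intro: joined_mem)
  then show ?thesis using finite_level[OF F(1)] finite_subset by blast
qed

text \<open>Each piece containing \<beta> contains \<alpha>. A nonnegative value puts \<alpha> in
  exactly one piece, which is then the only one containing \<beta>.\<close>

lemma Xi_joined:
  assumes "joined k \<alpha> \<beta>" "\<alpha> \<le> \<beta>" "Xi m n r \<F> \<alpha> (Suc k) \<ge> 0"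
  shows "Xi m n r \<F> \<beta> (Suc k) = Xi m n r \<F> \<alpha> (Suc k)"
proof -
  obtain F where F: "F \<in> level m \<F> (Suc k)" "\<beta> \<in> F" using ex_level by blast
  obtain G H where GH: "decomposition m n r \<F> k F [G, H] (G \<inter> H)"
    "G \<in> level m \<F> k" "H \<in> level m \<F> k" "F = G \<union> H"
    using decomposition_exists[OF F(1)] .
  have "\<beta> \<in> G \<Longrightarrow> \<alpha> \<in> G" "\<beta> \<in> H \<Longrightarrow> \<alpha> \<in> H"
    using joined_mem[OF assms(1,2)] GH(2,3) by simp_all
  moreover from this have "\<alpha> \<in> F" using F(2) GH(4) by blast
  ultimately show ?thesis
    using assms(3) Xi_Suc[OF F(1) GH(1) F(2)] Xi_Suc[OF F(1) GH(1) \<open>\<alpha> \<in> F\<close>] F(2) GH(4)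
    by (auto split: if_splits)
qed

text \<open>No piece contains both points. As \<open>G\<close> is an initial segment, \<beta> in
  \<open>G\<close> would bring \<alpha> along; hence \<beta> is only in \<open>H\<close> and
  \<alpha> only in \<open>G\<close>.\<close>

lemma Xi_separated:
  assumes "\<not> joined k \<alpha> \<beta>" "joined (Suc k) \<alpha> \<beta>" "\<alpha> < \<beta>"
  shows "Xi m n r \<F> \<alpha> (Suc k) = 0" "Xi m n r \<F> \<beta> (Suc k) = 1"
proof -
  obtain F where F: "F \<in> level m \<F> (Suc k)" "\<alpha> \<in> F" "\<beta> \<in> F"
    using assms(2) unfolding joined_def by blast
  obtain G H where GH: "decomposition m n r \<F> k F [G, H] (G \<inter> H)"
    "G \<in> level m \<F> k" "H \<in> level m \<F> k" "F = G \<union> H"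
    using decomposition_exists[OF F(1)] .
  have "\<not> (\<alpha> \<in> G \<and> \<beta> \<in> G)" "\<not> (\<alpha> \<in> H \<and> \<beta> \<in> H)"
    using assms(1) GH(2,3) unfolding joined_def by blast+
  moreover have "\<beta> \<in> G \<Longrightarrow> \<alpha> \<in> G"
    using decomposition_initial_segment(2)[OF GH(1)] F(2) assms(3)
    unfolding initial_segment_def by blast
  ultimately show "Xi m n r \<F> \<alpha> (Suc k) = 0" "Xi m n r \<F> \<beta> (Suc k) = 1"
    using Xi_Suc[OF F(1) GH(1)] F(2,3) GH(4) by auto
qed

lemma Xi_values: "Xi m n r \<F> \<alpha> k \<in> {-1, 0, 1}"
proof (cases k)
  case (Suc l)
  obtain F where F: "F \<in> level m \<F> (Suc l)" "\<alpha> \<in> F" using ex_level by blast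
  obtain G H where "decomposition m n r \<F> l F [G, H] (G \<inter> H)"
    using decomposition_exists[OF F(1)] .
  from Xi_Suc[OF F(1) this F(2)] show ?thesis unfolding Suc by simp
qed (simp add: Xi_def)

lemma Xi_eventually:
  assumes "\<alpha> \<le> \<beta>"
  shows "\<exists>N. \<forall>k>N. Xi m n r \<F> \<alpha> k \<ge> 0 \<longrightarrow> Xi m n r \<F> \<beta> k = Xi m n r \<F> \<alpha> k"
proof -
  obtain N where N: "joined N \<alpha> \<beta>" using ex_joined by blast
  have "Xi m n r \<F> \<beta> k = Xi m n r \<F> \<alpha> k" if k: "N < k" "Xi m n r \<F> \<alpha> k \<ge> 0" for k
  proof -
    \<comment> \<open>Being joined at level \<open>l\<close> controls the values at level
      \<open>Suc l\<close>, hence the strict bound \<open>N < k\<close>.\<close>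
    obtain l where "k = Suc l" "N \<le> l" using k(1) by (cases k) auto
    then show ?thesis using Xi_joined[OF joined_mono[OF N]] assms k(2) by simp
  qed
  then show ?thesis by blast
qed

lemma ex_Xi_separated:
  assumes "\<alpha> < \<beta>" "\<not> joined N \<alpha> \<beta>"
  obtains k where "N < k" "Xi m n r \<F> \<alpha> k = 0" "Xi m n r \<F> \<beta> k = 1"
proof -
  define k where "k = (LEAST k. joined k \<alpha> \<beta>)"
  have k: "joined k \<alpha> \<beta>" unfolding k_def using ex_joined by (rule LeastI_ex)
  \<comment> \<open>Were \<open>k \<le> N\<close>, monotonicity would join the points at
    \<open>N\<close>. So \<open>k\<close> is positive, and by minimality its predecessor does not
    join them.\<close>
  then have "N < k" using joined_mono assms by (meson less_imp_le not_le)
  then obtain l where l: "k = Suc l" by (cases k) auto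
  then have "\<not> joined l \<alpha> \<beta>" using not_less_Least[of l "\<lambda>k. joined k \<alpha> \<beta>"] k_def by auto
  then show thesis using that[of k] Xi_separated[of l \<alpha> \<beta>] k assms(1) \<open>N < k\<close> l by simp
qed

section \<open>The two sequences of sets\<close>

text \<open>The equation is over \<open>int\<close> because \<Xi> takes the value -1.\<close>

definition left :: "omega1 \<Rightarrow> nat set" where
  "left \<alpha> = {j. \<exists>k\<ge>1. Xi m n r \<F> \<alpha> k \<ge> 0 \<and> int j = 2 * int k + Xi m n r \<F> \<alpha> k}"

definition right :: "omega1 \<Rightarrow> nat set" where
  "right \<alpha> = {j. \<exists>k\<ge>1. Xi m n r \<F> \<alpha> k \<ge> 0 \<and> int j = 2 * int k + (1 - Xi m n r \<F> \<alpha> k)}"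

text \<open>The level of an element \<open>j\<close> of \<open>left \<alpha>\<close> or \<open>right \<alpha>\<close> is \<open>j div 2\<close>.\<close>

lemma mem_left_iff:
  "j \<in> left \<alpha> \<longleftrightarrow> 2 \<le> j \<and> Xi m n r \<F> \<alpha> (j div 2) = int (j mod 2)"
proof
  assume "j \<in> left \<alpha>"
  then obtain k where k: "k \<ge> 1" "Xi m n r \<F> \<alpha> k \<ge> 0" "int j = 2 * int k + Xi m n r \<F> \<alpha> k"
    unfolding left_def by blast
  then have "j div 2 = k" "Xi m n r \<F> \<alpha> k = int (j mod 2)"
    using Xi_values[of \<alpha> k] by auto presburger+
  then show "2 \<le> j \<and> Xi m n r \<F> \<alpha> (j div 2) = int (j mod 2)" using k by auto
next
  assume "2 \<le> j \<and> Xi m n r \<F> \<alpha> (j div 2) = int (j mod 2)"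
  moreover have "int j = 2 * int (j div 2) + int (j mod 2)" by presburger
  ultimately show "j \<in> left \<alpha>"
    unfolding left_def by (intro CollectI exI[of _ "j div 2"]) auto
qed

lemma mem_right_iff:
  "j \<in> right \<alpha> \<longleftrightarrow> 2 \<le> j \<and> Xi m n r \<F> \<alpha> (j div 2) = 1 - int (j mod 2)"
proof
  assume "j \<in> right \<alpha>"
  then obtain k where k: "k \<ge> 1" "Xi m n r \<F> \<alpha> k \<ge> 0"
      "int j = 2 * int k + (1 - Xi m n r \<F> \<alpha> k)"
    unfolding right_def by blast
  then have "j div 2 = k" "Xi m n r \<F> \<alpha> k = 1 - int (j mod 2)"
    using Xi_values[of \<alpha> k] by auto presburger+
  then show "2 \<le> j \<and> Xi m n r \<F> \<alpha> (j div 2) = 1 - int (j mod 2)" using k by auto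
next
  assume *: "2 \<le> j \<and> Xi m n r \<F> \<alpha> (j div 2) = 1 - int (j mod 2)"
  moreover have "int j = 2 * int (j div 2) + int (j mod 2)" "int (j mod 2) \<le> 1" by presburger+
  ultimately show "j \<in> right \<alpha>"
    unfolding right_def by (intro CollectI exI[of _ "j div 2"]) auto
qed

text \<open>A point in any of the four sets shown finite witnesses different values at \<alpha> and
  \<beta>, which is impossible above the level \<open>N\<close>. Allowing \<alpha> = \<beta> and
  treating both mixed intersections covers all pairs of indices.\<close>

lemma pregap_left_right: "pregap left right"
proof -
  have bounded: "finite A" if "\<And>j. j \<in> A \<Longrightarrow> \<not> N < j div 2" for A and N :: nat
  proof (rule finite_subset)
    show "A \<subseteq> {..2 * N + 1}" using that by fastforce
  qed simp
  have almost: "almost_subset (left \<alpha>) (left \<beta>)" "almost_subset (right \<alpha>) (right \<beta>)"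
    "finite (left \<alpha> \<inter> right \<beta>)" "finite (left \<beta> \<inter> right \<alpha>)" if ordered: "\<alpha> \<le> \<beta>" for \<alpha> \<beta>
  proof -
    obtain N where N: "\<And>k. N < k \<Longrightarrow> Xi m n r \<F> \<alpha> k \<ge> 0 \<Longrightarrow> Xi m n r \<F> \<beta> k = Xi m n r \<F> \<alpha> k"
      using Xi_eventually[OF ordered] by blast
    have le: "int (j mod 2) \<le> 1" for j :: nat by presburger
    have neq: "int (j mod 2) \<noteq> 1 - int (j mod 2)" for j :: nat by presburger
    have "\<not> N < j div 2" if "j \<in> left \<alpha> - left \<beta> \<or> j \<in> right \<alpha> - right \<beta>
        \<or> j \<in> left \<alpha> \<inter> right \<beta> \<or> j \<in> left \<beta> \<inter> right \<alpha>" for j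
    proof
      assume "N < j div 2"
      \<comment> \<open>In each of the four cases \<open>j\<close> belongs to
        \<open>left \<alpha>\<close> or \<open>right \<alpha>\<close>.\<close>
      moreover have "Xi m n r \<F> \<alpha> (j div 2) \<ge> 0"
        using that le[of j] by (auto simp: mem_left_iff mem_right_iff)
      ultimately have "Xi m n r \<F> \<beta> (j div 2) = Xi m n r \<F> \<alpha> (j div 2)" using N by blast
      then show False using that neq[of j] by (auto simp: mem_left_iff mem_right_iff)
    qed
    then show "almost_subset (left \<alpha>) (left \<beta>)" "almost_subset (right \<alpha>) (right \<beta>)"
      "finite (left \<alpha> \<inter> right \<beta>)" "finite (left \<beta> \<inter> right \<alpha>)"
      unfolding almost_subset_def by (auto intro!: bounded[of _ N])
  qed
  then show ?thesis unfolding pregap_def by (meson less_imp_le linear)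
qed

lemma hausdorff_left_right: "hausdorff left right"
  unfolding hausdorff_def
proof (intro allI)
  fix \<beta> N
  have "joined N \<alpha> \<beta>"
    if less: "\<alpha> < \<beta>" and sub: "left \<beta> \<inter> right \<alpha> \<subseteq> {..<N}" for \<alpha>
  proof (rule ccontr)
    assume "\<not> joined N \<alpha> \<beta>"
    then obtain k where k: "N < k" "Xi m n r \<F> \<alpha> k = 0" "Xi m n r \<F> \<beta> k = 1"
      using ex_Xi_separated[OF less] by blast
    \<comment> \<open>The value 1 in \<open>left\<close> and the value 0 in \<open>right\<close> are
      both coded by the odd number of level \<open>k\<close>.\<close>
    then have "2 * k + 1 \<in> left \<beta> \<inter> right \<alpha>" by (simp add: mem_left_iff mem_right_iff)
    then show False using k(1) sub by auto
  qed
  then have "{\<alpha>. \<alpha> < \<beta> \<and> left \<beta> \<inter> right \<alpha> \<subseteq> {..<N}} \<subseteq> {\<alpha>. \<alpha> \<le> \<beta> \<and> joined N \<alpha> \<beta>}"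
    by auto
  then show "finite {\<alpha>. \<alpha> < \<beta> \<and> left \<beta> \<inter> right \<alpha> \<subseteq> {..<N}}"
    using finite_joined finite_subset by blast
qed

end

theorem mainTheorem4:
  fixes m n r :: "nat \<Rightarrow> nat" and \<F> :: "omega1 set set"
    and L R :: "omega1 \<Rightarrow> nat set"
  assumes "two_construction_scheme m n r \<F>"
    and "\<And>\<alpha>. L \<alpha> = {j. \<exists>k\<ge>1. Xi m n r \<F> \<alpha> k \<ge> 0 \<and> int j = 2 * int k + Xi m n r \<F> \<alpha> k}"
    and "\<And>\<alpha>. R \<alpha> = {j. \<exists>k\<ge>1. Xi m n r \<F> \<alpha> k \<ge> 0 \<and> int j = 2 * int k + (1 - Xi m n r \<F> \<alpha> k)}"
  shows "hausdorff_gap L R"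
proof -
  interpret two_scheme m n r \<F> using assms(1) by unfold_locales
  have "L = left" "R = right" using assms(2,3) by (auto simp: left_def right_def)
  then show ?thesis
    using pregap_left_right hausdorff_left_right hausdorff_no_separation
    unfolding hausdorff_gap_def gap_def by blast
qed

end
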